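(* Let $z$ be an indeterminate (treated as a scalar) and let $A=\{a_0,a_1,a_2,\dots,b,c\}$ be an alphabet. For each $k\ge 1$ let $G_k$ be the context-free grammar $$G_k=\{a_0\to a_1c,\ a_1\to a_2bc,\ a_2\to a_3b^2c,\ \dots,\ a_{k-1}\to a_kb^{k-1}c,\ b\to 2b,\ c\to(1+z)c\},$$ and let $D_k$ be the formal derivative associated with $G_k$. Then for every $n\ge 1$, $$D_nD_{n-1}\cdots D_1(a_0)=\sum_{k=1}^n \mathrm{JS}_n^k(z)\,a_k\,b^{\binom{k}{2}}c^k.$$
   Context: A context-free grammar $G$ over an alphabet $A$ assigns to each letter of $A$ an element of the ring $\mathbb{Q}[z][[A]]$ of formal power series in the letters of $A$ (with scalars polynomials in $z$). The formal derivative $D=D_G$ is the unique $\mathbb{Q}[z]$-linear derivation (satisfying the Leibniz rule on products) with $D(x)=G(x)$ for each letter $x$; letters without a rule in $G$ (here $a_j$ for $j\ge k$ in $G_k$) are mapped to $0$. The Jacobi-Stirling numbers of the second kind $\mathrm{JS}_n^k(z)$ are defined by $\mathrm{JS}_n^k(z)=\mathrm{JS}_{n-1}^{k-1}(z)+k(k+z)\mathrm{JS}_{n-1}^k(z)$ with $\mathrm{JS}_n^0(z)=\delta_{n,0}$ and $\mathrm{JS}_0^k(z)=\delta_{0,k}$; equivalently $x^n=\sum_{k=0}^n\mathrm{JS}_n^k(z)\prod_{i=0}^{k-1}(x-i(z+i))$. *)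

theory Defs
  imports "HOL-Library.Poly_Mapping" "HOL-Computational_Algebra.Polynomial"
begin

section \<open>Formal power series over an arbitrary set of commuting letters\<close>

text \<open>
  A monomial is a finitely supported exponent function; a series assigns a coefficient to
  every monomial.
\<close>

typedef ('x, 'a) mfps = "UNIV :: (('x \<Rightarrow>\<^sub>0 nat) \<Rightarrow> 'a) set"
  morphisms mfps_nth Abs_mfps ..

lemma mfps_nth_Abs [simp]: "mfps_nth (Abs_mfps f) = f"
  by (simp add: Abs_mfps_inverse)

lemma mfps_eqI: "(\<And>m. mfps_nth f m = mfps_nth g m) \<Longrightarrow> f = g"
  by (metis ext mfps_nth_inject)

definition splits :: "('x \<Rightarrow>\<^sub>0 nat) \<Rightarrow> (('x \<Rightarrow>\<^sub>0 nat) \<times> ('x \<Rightarrow>\<^sub>0 nat)) set" where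
  "splits m = {(p, q). p + q = m}"

lemma finite_splits [simp]: "finite (splits m)"
proof -
  define K where "K = Poly_Mapping.keys m"
  define N where "N = {0..Max (insert 0 (Poly_Mapping.lookup m ` K))}"
  have finK: "finite K" by (simp add: K_def)
  have bound: "Poly_Mapping.lookup p \<in> {f. \<forall>x. (x \<in> K \<longrightarrow> f x \<in> N) \<and> (x \<notin> K \<longrightarrow> f x = 0)}"
    if "p + q = m" for p q
  proof (intro CollectI allI conjI impI)
    fix x
    have le: "Poly_Mapping.lookup p x \<le> Poly_Mapping.lookup m x"
      using that by (auto simp: lookup_add)
    show "Poly_Mapping.lookup p x = 0" if "x \<notin> K"
      using le that by (simp add: K_def in_keys_iff)
    show "Poly_Mapping.lookup p x \<in> N" if "x \<in> K"
    proof -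
      have "Poly_Mapping.lookup m x \<le> Max (insert 0 (Poly_Mapping.lookup m ` K))"
        using that finK by (intro Max_ge) auto
      with le show ?thesis by (simp add: N_def)
    qed
  qed
  have "finite {f. \<forall>x. (x \<in> K \<longrightarrow> f x \<in> N) \<and> (x \<notin> K \<longrightarrow> f x = (0::nat))}"
    using finK by (intro finite_set_of_finite_funs) (auto simp: N_def)
  hence fin: "finite (Poly_Mapping.lookup -` {f. \<forall>x. (x \<in> K \<longrightarrow> f x \<in> N) \<and> (x \<notin> K \<longrightarrow> f x = 0)})"
    by (rule finite_vimageI) (simp add: inj_on_def lookup_inject)
  show ?thesis
  proof (rule finite_subset[OF _ finite_imageI[OF fin]])
    show "splits m \<subseteq> (\<lambda>p. (p, m - p)) `
      (Poly_Mapping.lookup -` {f. \<forall>x. (x \<in> K \<longrightarrow> f x \<in> N) \<and> (x \<notin> K \<longrightarrow> f x = 0)})"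
    proof
      fix pq assume "pq \<in> splits m"
      then obtain p q where pq: "pq = (p, q)" "p + q = m" by (auto simp: splits_def)
      have "q = m - p" using pq(2) by (metis add_diff_cancel_left')
      with pq bound[OF pq(2)] show "pq \<in> (\<lambda>p. (p, m - p)) `
        (Poly_Mapping.lookup -` {f. \<forall>x. (x \<in> K \<longrightarrow> f x \<in> N) \<and> (x \<notin> K \<longrightarrow> f x = 0)})"
        by blast
    qed
  qed
qed

definition mfps_monom :: "'a::zero \<Rightarrow> ('x \<Rightarrow>\<^sub>0 nat) \<Rightarrow> ('x, 'a) mfps" where
  "mfps_monom c p = Abs_mfps (\<lambda>m. if m = p then c else 0)"

instantiation mfps :: (type, comm_ring_1) comm_ring_1
begin

definition "0 = Abs_mfps (\<lambda>_. 0)"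
definition "1 = mfps_monom 1 0"
definition "f + g = Abs_mfps (\<lambda>m. mfps_nth f m + mfps_nth g m)"
definition "f - g = Abs_mfps (\<lambda>m. mfps_nth f m - mfps_nth g m)"
definition "- f = Abs_mfps (\<lambda>m. - mfps_nth f m)"
definition "f * g = Abs_mfps (\<lambda>m. \<Sum>(p, q)\<in>splits m. mfps_nth f p * mfps_nth g q)"

instance
proof
  fix f g h :: "('a, 'b) mfps"
  show "f + g + h = f + (g + h)" "f + g = g + f" "0 + f = f" "- f + f = 0" "f - g = f + - g"
    by (auto intro!: mfps_eqI
        simp: plus_mfps_def zero_mfps_def uminus_mfps_def minus_mfps_def add_ac)
  show "(0 :: ('a, 'b) mfps) \<noteq> 1"
  proof
    assume "(0 :: ('a, 'b) mfps) = 1"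
    hence "mfps_nth (0 :: ('a, 'b) mfps) 0 = mfps_nth 1 0" by simp
    thus False by (simp add: zero_mfps_def one_mfps_def mfps_monom_def)
  qed
  show comm: "f * g = g * f" for f g :: "('a, 'b) mfps"
  proof (rule mfps_eqI)
    fix m
    show "mfps_nth (f * g) m = mfps_nth (g * f) m"
      unfolding times_mfps_def mfps_nth_Abs
      by (rule sum.reindex_bij_witness[of _ "\<lambda>(p, q). (q, p)" "\<lambda>(p, q). (q, p)"])
         (auto simp: splits_def add_ac mult_ac)
  qed
  show "(f + g) * h = f * h + g * h"
    by (rule mfps_eqI)
       (simp add: times_mfps_def plus_mfps_def case_prod_beta distrib_right sum.distrib)
  show "1 * f = f"
  proof (rule mfps_eqI)
    fix m
    have "mfps_nth (1 * f) m = (\<Sum>z\<in>splits m. if z = (0, m) then mfps_nth f m else 0)"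
      unfolding times_mfps_def mfps_nth_Abs one_mfps_def mfps_monom_def case_prod_beta
      by (intro sum.cong refl) (auto simp: splits_def)
    also have "\<dots> = mfps_nth f m"
      unfolding sum.delta[OF finite_splits] by (simp add: splits_def)
    finally show "mfps_nth (1 * f) m = mfps_nth f m" .
  qed
  show "f * g * h = f * (g * h)"
  proof (rule mfps_eqI)
    fix m
    have "mfps_nth (f * g * h) m =
      (\<Sum>s\<in>splits m. \<Sum>t\<in>splits (fst s). mfps_nth f (fst t) * mfps_nth g (snd t) * mfps_nth h (snd s))"
      by (simp add: times_mfps_def case_prod_beta sum_distrib_right)
    also have "\<dots> = (\<Sum>(s, t)\<in>Sigma (splits m) (\<lambda>s. splits (fst s)).
        mfps_nth f (fst t) * mfps_nth g (snd t) * mfps_nth h (snd s))"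
      by (subst sum.Sigma) auto
    also have "\<dots> = (\<Sum>(s, t)\<in>Sigma (splits m) (\<lambda>s. splits (snd s)).
        mfps_nth f (fst s) * (mfps_nth g (fst t) * mfps_nth h (snd t)))"
      by (rule sum.reindex_bij_witness
            [of _ "\<lambda>((a, b), (c, d)). ((a + c, d), (a, c))" "\<lambda>((a, b), (c, d)). ((c, d + b), (d, b))"])
         (auto simp: splits_def add_ac mult_ac)
    also have "\<dots> = (\<Sum>s\<in>splits m. \<Sum>t\<in>splits (snd s).
        mfps_nth f (fst s) * (mfps_nth g (fst t) * mfps_nth h (snd t)))"
      by (subst sum.Sigma) auto
    also have "\<dots> = mfps_nth (f * (g * h)) m"
      by (simp add: times_mfps_def case_prod_beta sum_distrib_left)
    finally show "mfps_nth (f * g * h) m = mfps_nth (f * (g * h)) m" .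
  qed
qed

end

lemma mfps_nth_0 [simp]: "mfps_nth 0 m = 0"
  and mfps_nth_add [simp]: "mfps_nth (f + g) m = mfps_nth f m + mfps_nth g m"
  and mfps_nth_diff [simp]: "mfps_nth (f - g) m = mfps_nth f m - mfps_nth g m"
  and mfps_nth_uminus [simp]: "mfps_nth (- f) m = - mfps_nth f m"
  by (simp_all add: zero_mfps_def plus_mfps_def minus_mfps_def uminus_mfps_def)

lemma mfps_nth_mult:
  "mfps_nth (f * g) m = (\<Sum>(p, q)\<in>splits m. mfps_nth f p * mfps_nth g q)"
  by (simp add: times_mfps_def)

lemma mfps_nth_monom [simp]: "mfps_nth (mfps_monom c p) m = (if m = p then c else 0)"
  by (simp add: mfps_monom_def)

lemma mfps_nth_sum: "mfps_nth (sum f S) m = (\<Sum>i\<in>S. mfps_nth (f i) m)"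
  by (induction S rule: infinite_finite_induct) simp_all

lemma mfps_monom_mult:
  "mfps_monom c p * mfps_monom d q = mfps_monom (c * d :: 'a :: comm_ring_1) (p + q)"
proof (rule mfps_eqI)
  fix m
  have "mfps_nth (mfps_monom c p * mfps_monom d q) m =
      (\<Sum>z\<in>splits m. if z = (p, q) then c * d else 0)"
    unfolding mfps_nth_mult case_prod_beta by (intro sum.cong refl) (auto simp: prod_eq_iff)
  also have "\<dots> = mfps_nth (mfps_monom (c * d) (p + q)) m"
    unfolding sum.delta[OF finite_splits] by (auto simp: splits_def)
  finally show "mfps_nth (mfps_monom c p * mfps_monom d q) m
    = mfps_nth (mfps_monom (c * d) (p + q)) m" .
qed

definition mfps_const :: "'a::zero \<Rightarrow> ('x, 'a) mfps" where
  "mfps_const c = mfps_monom c 0"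

definition mfps_letter :: "'x \<Rightarrow> ('x, 'a::zero_neq_one) mfps" where
  "mfps_letter x = mfps_monom 1 (Poly_Mapping.single x 1)"

lemma mfps_const_1: "mfps_const 1 = (1 :: ('x, 'a :: comm_ring_1) mfps)"
  by (simp add: mfps_const_def one_mfps_def)

lemma mfps_const_add: "mfps_const (c + d) = (mfps_const c + mfps_const d :: ('x, 'a :: comm_ring_1) mfps)"
  by (rule mfps_eqI) (simp add: mfps_const_def)

lemma mfps_const_mult: "mfps_const (c * d) = (mfps_const c * mfps_const d :: ('x, 'a :: comm_ring_1) mfps)"
  by (simp add: mfps_const_def mfps_monom_mult)

lemma mfps_nth_const_mult [simp]:
  "mfps_nth (mfps_const c * f) m = c * mfps_nth f m" for c :: "'a :: comm_ring_1"
proof -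
  have "mfps_nth (mfps_const c * f) m = (\<Sum>z\<in>splits m. if z = (0, m) then c * mfps_nth f m else 0)"
    unfolding mfps_nth_mult mfps_const_def case_prod_beta
    by (intro sum.cong refl) (auto simp: splits_def)
  also have "\<dots> = c * mfps_nth f m"
    unfolding sum.delta[OF finite_splits] by (auto simp: splits_def)
  finally show ?thesis .
qed


section \<open>The formal derivative of a context-free grammar\<close>

text \<open>
  A grammar is a function from letters to series; a letter without a production rule is mapped
  to 0. On power series in infinitely many letters a derivation is determined by its values on the
  letters only if it is also compatible with infinite sums. The last conjunct of the
  following definition expresses this: it is continuity for coefficientwise convergence, each
  coefficient of the result depending on only finitely many coefficients of the argument.
\<close>

definition is_formal_derivative ::
  "('x \<Rightarrow> ('x, 'a::comm_ring_1) mfps) \<Rightarrow> (('x, 'a) mfps \<Rightarrow> ('x, 'a) mfps) \<Rightarrow> bool" where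
  "is_formal_derivative G D \<longleftrightarrow>
     (\<forall>f g. D (f + g) = D f + D g) \<and>
     (\<forall>c f. D (mfps_const c * f) = mfps_const c * D f) \<and>
     (\<forall>f g. D (f * g) = D f * g + f * D g) \<and>
     (\<forall>x. D (mfps_letter x) = G x) \<and>
     (\<forall>m. \<exists>S. finite S \<and> (\<forall>f. (\<forall>p\<in>S. mfps_nth f p = 0) \<longrightarrow> mfps_nth (D f) m = 0))"

definition formal_derivative ::
  "('x \<Rightarrow> ('x, 'a::comm_ring_1) mfps) \<Rightarrow> ('x, 'a) mfps \<Rightarrow> ('x, 'a) mfps" where
  "formal_derivative G = (THE D. is_formal_derivative G D)"

text \<open>
  If only finitely many letters have a nonzero production, such a derivation exists and is
  unique. Existence is shown using partial derivatives.
\<close>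

definition mfps_pderiv :: "'x \<Rightarrow> ('x, 'a::comm_ring_1) mfps \<Rightarrow> ('x, 'a) mfps" where
  "mfps_pderiv x f = Abs_mfps (\<lambda>m. of_nat (Suc (Poly_Mapping.lookup m x)) *
     mfps_nth f (m + Poly_Mapping.single x 1))"

lemma mfps_nth_pderiv:
  "mfps_nth (mfps_pderiv x f) m = of_nat (Suc (Poly_Mapping.lookup m x)) *
     mfps_nth f (m + Poly_Mapping.single x 1)"
  by (simp add: mfps_pderiv_def)

lemma mfps_pderiv_add: "mfps_pderiv x (f + g) = mfps_pderiv x f + mfps_pderiv x g"
  by (rule mfps_eqI) (simp add: mfps_nth_pderiv algebra_simps)

lemma mfps_pderiv_const_mult: "mfps_pderiv x (mfps_const c * f) = mfps_const c * mfps_pderiv x f"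
  by (rule mfps_eqI) (simp add: mfps_nth_pderiv mult.left_commute)

lemma add_single_diff:
  assumes "Poly_Mapping.lookup p x \<noteq> (0 :: nat)"
  shows "p - Poly_Mapping.single x 1 + Poly_Mapping.single x 1 = p"
  using assms by (intro poly_mapping_eqI) (auto simp: lookup_add lookup_minus lookup_single when_def)

lemma pderiv_mult_aux:
  "(\<Sum>(p, q)\<in>splits (m + Poly_Mapping.single x 1).
      of_nat (Poly_Mapping.lookup p x) * mfps_nth f p * mfps_nth g q)
   = mfps_nth (mfps_pderiv x f * g) m"
proof -
  let ?e = "Poly_Mapping.single x (1 :: nat)"
  have "(\<Sum>(p, q)\<in>splits (m + ?e). of_nat (Poly_Mapping.lookup p x) * mfps_nth f p * mfps_nth g q)
     = (\<Sum>(p, q)\<in>{(p, q)\<in>splits (m + ?e). Poly_Mapping.lookup p x \<noteq> 0}.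
          of_nat (Poly_Mapping.lookup p x) * mfps_nth f p * mfps_nth g q)"
    by (rule sum.mono_neutral_right) (auto intro: gr0I)
  also have "\<dots> = (\<Sum>(p, q)\<in>splits m. of_nat (Suc (Poly_Mapping.lookup p x)) *
      mfps_nth f (p + ?e) * mfps_nth g q)"
  proof (rule sum.reindex_bij_witness[of _ "\<lambda>(p, q). (p + ?e, q)" "\<lambda>(p, q). (p - ?e, q)"], goal_cases)
    case (1 a)
    then show ?case using add_single_diff[of "fst a" x] by auto
  next
    case (2 a)
    then obtain p q where a: "a = (p, q)" "p + q = m + ?e" "Poly_Mapping.lookup p x \<noteq> 0"
      by (auto simp: splits_def)
    have "(p - ?e + q) + ?e = (p - ?e + ?e) + q" by (simp add: add_ac)
    also have "\<dots> = m + ?e" using a add_single_diff[of p x] by simp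
    finally show ?case using a by (simp add: splits_def)
  next
    case (3 b)
    then show ?case by (cases b) simp
  next
    case (4 b)
    then show ?case by (auto simp: splits_def lookup_add add_ac)
  next
    case (5 a)
    then obtain p q where a: "a = (p, q)" "Poly_Mapping.lookup p x \<noteq> 0" by auto
    have "Suc (Poly_Mapping.lookup (p - ?e) x) = Poly_Mapping.lookup p x"
      using a by (simp add: lookup_minus)
    then show ?case using a add_single_diff[of p x] by (simp add: a(1) del: of_nat_Suc)
  qed
  also have "\<dots> = mfps_nth (mfps_pderiv x f * g) m"
    by (simp add: mfps_nth_mult mfps_nth_pderiv)
  finally show ?thesis .
qed

lemma mfps_pderiv_mult: "mfps_pderiv x (f * g) = mfps_pderiv x f * g + f * mfps_pderiv x g"
proof (rule mfps_eqI)
  fix m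
  let ?e = "Poly_Mapping.single x (1 :: nat)"
  have "mfps_nth (mfps_pderiv x (f * g)) m =
    (\<Sum>(p, q)\<in>splits (m + ?e). of_nat (Poly_Mapping.lookup (m + ?e) x) * (mfps_nth f p * mfps_nth g q))"
    by (simp add: mfps_nth_pderiv mfps_nth_mult sum_distrib_left case_prod_beta lookup_add)
  also have "\<dots> = (\<Sum>(p, q)\<in>splits (m + ?e).
      of_nat (Poly_Mapping.lookup p x) * mfps_nth f p * mfps_nth g q
      + of_nat (Poly_Mapping.lookup q x) * mfps_nth g q * mfps_nth f p)"
  proof (intro sum.cong refl, clarify)
    fix p q assume "(p, q) \<in> splits (m + ?e)"
    hence "m + ?e = p + q" by (simp add: splits_def)
    thus "of_nat (Poly_Mapping.lookup (m + ?e) x) * (mfps_nth f p * mfps_nth g q) =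
      of_nat (Poly_Mapping.lookup p x) * mfps_nth f p * mfps_nth g q
      + of_nat (Poly_Mapping.lookup q x) * mfps_nth g q * mfps_nth f p"
      by (simp add: lookup_add algebra_simps)
  qed
  also have "\<dots> = (\<Sum>(p, q)\<in>splits (m + ?e).
        of_nat (Poly_Mapping.lookup p x) * mfps_nth f p * mfps_nth g q)
      + (\<Sum>(p, q)\<in>splits (m + ?e). of_nat (Poly_Mapping.lookup q x) * mfps_nth g q * mfps_nth f p)"
    by (simp add: case_prod_beta sum.distrib)
  also have "(\<Sum>(p, q)\<in>splits (m + ?e). of_nat (Poly_Mapping.lookup q x) * mfps_nth g q * mfps_nth f p)
     = (\<Sum>(p, q)\<in>splits (m + ?e). of_nat (Poly_Mapping.lookup p x) * mfps_nth g p * mfps_nth f q)"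
    by (rule sum.reindex_bij_witness[of _ "\<lambda>(p, q). (q, p)" "\<lambda>(p, q). (q, p)"])
       (auto simp: splits_def add_ac)
  finally show "mfps_nth (mfps_pderiv x (f * g)) m =
      mfps_nth (mfps_pderiv x f * g + f * mfps_pderiv x g) m"
    unfolding pderiv_mult_aux by (simp add: mult.commute)
qed

lemma mfps_pderiv_letter: "mfps_pderiv x (mfps_letter y) = (if x = y then 1 else 0)"
proof (rule mfps_eqI)
  fix m
  have "m + Poly_Mapping.single x (1 :: nat) = Poly_Mapping.single y 1 \<longleftrightarrow> x = y \<and> m = 0"
  proof
    assume eq: "m + Poly_Mapping.single x (1 :: nat) = Poly_Mapping.single y 1"
    have "Poly_Mapping.lookup (m + Poly_Mapping.single x (1 :: nat)) x
        = Poly_Mapping.lookup (Poly_Mapping.single y 1) x"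
      by (simp only: eq)
    hence "x = y" by (auto simp: lookup_add lookup_single when_def split: if_splits)
    with eq show "x = y \<and> m = 0" by simp
  qed auto
  thus "mfps_nth (mfps_pderiv x (mfps_letter y)) m = mfps_nth (if x = y then 1 else 0) m"
    by (auto simp: mfps_nth_pderiv mfps_letter_def one_mfps_def)
qed

lemma is_formal_derivative_exists:
  assumes fin: "finite {x. G x \<noteq> 0}"
  shows "is_formal_derivative G (\<lambda>f. \<Sum>x | G x \<noteq> 0. G x * mfps_pderiv x f)"
  unfolding is_formal_derivative_def
proof (intro conjI allI)
  fix f g c
  show "(\<Sum>x | G x \<noteq> 0. G x * mfps_pderiv x (f + g)) =
     (\<Sum>x | G x \<noteq> 0. G x * mfps_pderiv x f) + (\<Sum>x | G x \<noteq> 0. G x * mfps_pderiv x g)"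
    by (simp add: mfps_pderiv_add distrib_left sum.distrib)
  show "(\<Sum>x | G x \<noteq> 0. G x * mfps_pderiv x (mfps_const c * f)) =
     mfps_const c * (\<Sum>x | G x \<noteq> 0. G x * mfps_pderiv x f)"
    by (simp add: mfps_pderiv_const_mult sum_distrib_left mult.left_commute)
  show "(\<Sum>x | G x \<noteq> 0. G x * mfps_pderiv x (f * g)) =
     (\<Sum>x | G x \<noteq> 0. G x * mfps_pderiv x f) * g + f * (\<Sum>x | G x \<noteq> 0. G x * mfps_pderiv x g)"
    by (simp add: mfps_pderiv_mult distrib_left sum.distrib sum_distrib_left sum_distrib_right mult_ac)
next
  fix y
  show "(\<Sum>x | G x \<noteq> 0. G x * mfps_pderiv x (mfps_letter y)) = G y"
    using fin by (simp add: mfps_pderiv_letter if_distrib sum.delta' cong: if_cong)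
next
  fix m
  define S where "S = (\<lambda>(x, p, q). q + Poly_Mapping.single x (1 :: nat)) ` ({x. G x \<noteq> 0} \<times> splits m)"
  have "finite S" unfolding S_def using fin by auto
  moreover have "mfps_nth (\<Sum>x | G x \<noteq> 0. G x * mfps_pderiv x f) m = 0"
    if f: "\<forall>p\<in>S. mfps_nth f p = 0" for f
  proof -
    have "mfps_nth f (q + Poly_Mapping.single x 1) = 0" if "G x \<noteq> 0" "(p, q) \<in> splits m" for x p q
      using f that by (force simp: S_def)
    thus ?thesis
      unfolding mfps_nth_sum mfps_nth_mult mfps_nth_pderiv
      by (intro sum.neutral ballI) (auto intro!: sum.neutral)
  qed
  ultimately show "\<exists>S. finite S \<and> (\<forall>f. (\<forall>p\<in>S. mfps_nth f p = 0) \<longrightarrow>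
      mfps_nth (\<Sum>x | G x \<noteq> 0. G x * mfps_pderiv x f) m = 0)"
    by blast
qed

lemma is_formal_derivative_unique:
  fixes G :: "'x \<Rightarrow> ('x, 'a::comm_ring_1) mfps"
  assumes "is_formal_derivative G D" "is_formal_derivative G E"
  shows "D = E"
proof
  fix f
  have D: "D (f + g) = D f + D g" "D (mfps_const c * f) = mfps_const c * D f"
      "D (f * g) = D f * g + f * D g" "D (mfps_letter x) = G x" for f g c x
    using assms(1) by (auto simp: is_formal_derivative_def)
  have E: "E (f + g) = E f + E g" "E (mfps_const c * f) = mfps_const c * E f"
      "E (f * g) = E f * g + f * E g" "E (mfps_letter x) = G x" for f g c x
    using assms(2) by (auto simp: is_formal_derivative_def)
  have D1: "D 1 = 0" and E1: "E 1 = 0"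
    using D(3)[of 1 1] E(3)[of 1 1] by simp_all
  have D0: "D 0 = 0" and E0: "E 0 = 0"
    using D(1)[of 0 0] E(1)[of 0 0] by simp_all
  have single: "D (mfps_monom 1 (Poly_Mapping.single x n)) = E (mfps_monom 1 (Poly_Mapping.single x n))"
    for x n
  proof (induction n)
    case 0
    show ?case using D1 E1 by (simp add: one_mfps_def)
  next
    case (Suc n)
    have eq: "mfps_monom (1 :: 'a) (Poly_Mapping.single x (Suc n)) =
      mfps_letter x * mfps_monom 1 (Poly_Mapping.single x n)"
      by (simp add: mfps_letter_def mfps_monom_mult flip: single_add)
    show ?case unfolding eq using Suc by (simp add: D E)
  qed
  have mon1: "D (mfps_monom 1 p) = E (mfps_monom 1 p)" for p
  proof (induction p rule: update_induct)
    case const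
    show ?case using single[of undefined 0] by simp
  next
    case (update p k v)
    have split: "Poly_Mapping.update k v p = Poly_Mapping.single k v + p"
      using update(1)
      by (intro poly_mapping_eqI)
         (auto simp: lookup_update lookup_add lookup_single when_def in_keys_iff)
    have eq: "mfps_monom (1 :: 'a) (Poly_Mapping.update k v p) =
        mfps_monom 1 (Poly_Mapping.single k v) * mfps_monom 1 p"
      by (simp add: mfps_monom_mult split)
    show ?case unfolding eq D(3) E(3) single update(3) ..
  qed
  have mon: "D (mfps_monom c p) = E (mfps_monom c p)" for c p
  proof -
    have eq: "mfps_monom c p = mfps_const c * mfps_monom 1 p"
      by (simp add: mfps_const_def mfps_monom_mult)
    show ?thesis unfolding eq by (simp only: D(2) E(2) mon1)
  qed
  have poly: "D (\<Sum>p\<in>S. mfps_monom (c p) p) = E (\<Sum>p\<in>S. mfps_monom (c p) p)" for c S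
    by (induction S rule: infinite_finite_induct) (simp_all add: D0 E0 D(1) E(1) mon)
  show "D f = E f"
  proof (rule mfps_eqI)
    fix m
    obtain S where S: "finite S" "\<And>f. (\<forall>p\<in>S. mfps_nth f p = 0) \<Longrightarrow> mfps_nth (D f) m = 0"
      using assms(1) unfolding is_formal_derivative_def by blast
    obtain T where T: "finite T" "\<And>f. (\<forall>p\<in>T. mfps_nth f p = 0) \<Longrightarrow> mfps_nth (E f) m = 0"
      using assms(2) unfolding is_formal_derivative_def by blast
    define P where "P = (\<Sum>p\<in>S \<union> T. mfps_monom (mfps_nth f p) p)"
    define R where "R = f - P"
    have R0: "mfps_nth R p = 0" if "p \<in> S \<union> T" for p
      using that S(1) T(1) by (simp add: R_def P_def mfps_nth_sum)
    have f: "f = P + R" by (simp add: R_def)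
    have "mfps_nth (D f) m = mfps_nth (D P) m" "mfps_nth (E f) m = mfps_nth (E P) m"
      unfolding f using S(2)[of R] T(2)[of R] R0 by (auto simp: D(1) E(1))
    thus "mfps_nth (D f) m = mfps_nth (E f) m"
      using poly by (simp add: P_def)
  qed
qed

lemma ex1_formal_derivative:
  assumes "finite {x. G x \<noteq> 0}"
  shows "\<exists>!D. is_formal_derivative G D"
  using is_formal_derivative_exists[OF assms] is_formal_derivative_unique by blast

lemma is_formal_derivative_formal_derivative:
  assumes "finite {x. G x \<noteq> 0}"
  shows "is_formal_derivative G (formal_derivative G)"
  unfolding formal_derivative_def by (rule theI'[OF ex1_formal_derivative[OF assms]])


section \<open>Jacobi-Stirling numbers and the grammars\<close>

text \<open>The scalars are the polynomials in one indeterminate over the rationals.\<close>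

definition zvar :: "rat poly" where
  "zvar = [:0, 1:]"

fun JS :: "nat \<Rightarrow> nat \<Rightarrow> rat poly" where
  "JS 0 k = (if k = 0 then 1 else 0)"
| "JS (Suc n) 0 = 0"
| "JS (Suc n) (Suc k) = JS n k + of_nat (Suc k) * (of_nat (Suc k) + zvar) * JS n (Suc k)"

datatype letter = LA nat | LB | LC

type_synonym series = "(letter, rat poly) mfps"

abbreviation sa :: "nat \<Rightarrow> series" where "sa j \<equiv> mfps_letter (LA j)"
abbreviation sb :: series where "sb \<equiv> mfps_letter LB"
abbreviation sc :: series where "sc \<equiv> mfps_letter LC"

fun grammar :: "nat \<Rightarrow> letter \<Rightarrow> series" where
  "grammar k (LA j) = (if j < k then sa (Suc j) * sb ^ j * sc else 0)"
| "grammar k LB = 2 * sb"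
| "grammar k LC = mfps_const (1 + zvar) * sc"

lemma finite_grammar: "finite {x. grammar k x \<noteq> 0}"
proof (rule finite_subset)
  show "{x. grammar k x \<noteq> 0} \<subseteq> LA ` {..<k} \<union> {LB, LC}"
  proof
    fix x assume "x \<in> {x. grammar k x \<noteq> 0}"
    thus "x \<in> LA ` {..<k} \<union> {LB, LC}" by (cases x) (auto split: if_splits)
  qed
qed auto

end

theory Submission
  imports Defs
begin

text \<open>
  Each monomial \<open>a\<^sub>k b\<^bsup>k choose 2\<^esup> c\<^sup>k\<close> is nearly an eigenvector of every \<open>D\<^sub>m\<close> with \<open>k < m\<close>:
  the letters \<open>b\<close> and \<open>c\<close> contribute the eigenvalue \<open>2 (k choose 2) + k (1 + z) = k (k + z)\<close>, and
  the rule for \<open>a\<^sub>k\<close> contributes exactly the next monomial. This is the recurrence of the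
  Jacobi-Stirling numbers.
\<close>

lemma is_formal_derivative_sum:
  assumes "is_formal_derivative G D"
  shows "D (sum f S) = (\<Sum>i\<in>S. D (f i))"
proof -
  have add: "D (f + g) = D f + D g" for f g
    using assms by (simp add: is_formal_derivative_def)
  have "D 0 = 0"
    using add[of 0 0] by simp
  thus ?thesis
    by (induction S rule: infinite_finite_induct) (simp_all add: add)
qed

text \<open>By the Leibniz rule each factor contributes \<open>e\<close> once. The intended cases
  are \<open>sb\<close> with \<open>e = 2\<close> and \<open>sc\<close> with
  \<open>e = 1 + z\<close>.\<close>

lemma is_formal_derivative_eigen_power:
  assumes "is_formal_derivative G D" and "D f = e * f"
  shows "D (f ^ n) = of_nat n * e * f ^ n"
proof (induction n)
  case 0
  \<comment> \<open>This reads \<open>D 1 = D 1 + D 1\<close>, which forces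
    \<open>D 1 = 0\<close>.\<close>
  have "D (1 * 1) = D 1 * 1 + 1 * D 1"
    using assms(1) unfolding is_formal_derivative_def by blast
  thus ?case by simp
next
  case (Suc n)
  have "D (f * f ^ n) = D f * f ^ n + f * D (f ^ n)"
    using assms(1) unfolding is_formal_derivative_def by blast
  thus ?case by (simp add: Suc assms(2) algebra_simps)
qed

lemma mfps_const_of_nat: "mfps_const (of_nat n) = (of_nat n :: ('x, 'a::comm_ring_1) mfps)"
proof (induction n)
  case 0
  show ?case by (rule mfps_eqI) (simp add: mfps_const_def)
qed (simp add: mfps_const_add mfps_const_1)

lemma JS_eq_0: "n < k \<Longrightarrow> JS n k = 0"
  by (induction n k rule: JS.induct) simp_all

definition js_monom :: "nat \<Rightarrow> series" where
  "js_monom k = sa k * sb ^ (k choose 2) * sc ^ k"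

lemma choose_two_Suc: "Suc k choose 2 = k + (k choose 2)"
  by (simp add: numeral_2_eq_2)

lemma formal_derivative_js_monom:
  assumes "k < m"
  shows "formal_derivative (grammar m) (js_monom k) =
    js_monom (Suc k) + mfps_const (of_nat k * (of_nat k + zvar)) * js_monom k"
proof -
  define D where "D = formal_derivative (grammar m)"
  have isD: "is_formal_derivative (grammar m) D"
    unfolding D_def by (rule is_formal_derivative_formal_derivative[OF finite_grammar])
  have mult: "D (f * g) = D f * g + f * D g" for f g
    using isD unfolding is_formal_derivative_def by blast
  have letter: "D (mfps_letter x) = grammar m x" for x
    using isD unfolding is_formal_derivative_def by blast
  \<comment> \<open>Here \<open>k < m\<close> matters: it ensures that \<open>sa k\<close> has a
    production in \<open>grammar m\<close>.\<close>
  have a: "D (sa k) = sa (Suc k) * sb ^ k * sc"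
    using assms by (simp add: letter)
  have b: "D (sb ^ j) = of_nat j * 2 * sb ^ j" for j
    by (rule is_formal_derivative_eigen_power[OF isD]) (simp add: letter)
  have c: "D (sc ^ j) = of_nat j * mfps_const (1 + zvar) * sc ^ j" for j
    by (rule is_formal_derivative_eigen_power[OF isD]) (simp add: letter)
  have "2 * (k choose 2) + k = k * k"
    by (induction k) (simp_all add: choose_two_Suc)
  hence "of_nat (2 * (k choose 2) + k) = (of_nat (k * k) :: series)"
    by simp
  hence kk: "of_nat k * of_nat k = 2 * of_nat (k choose 2) + (of_nat k :: series)"
    by simp
  have ev: "mfps_const (of_nat k * (of_nat k + zvar)) =
      of_nat (k choose 2) * 2 + of_nat k * (mfps_const (1 + zvar) :: series)"
    by (simp add: mfps_const_add mfps_const_mult mfps_const_of_nat mfps_const_1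
        distrib_left kk)
  \<comment> \<open>The factor \<open>sb ^ k\<close> produced from \<open>sa k\<close> raises the
    exponent \<open>k choose 2\<close> of \<open>sb\<close> to
    \<open>Suc k choose 2\<close>.\<close>
  have "D (js_monom k) = js_monom (Suc k) +
      (of_nat (k choose 2) * 2 + of_nat k * mfps_const (1 + zvar)) * js_monom k"
    unfolding js_monom_def choose_two_Suc
    by (simp add: mult a b c power_add algebra_simps)
  thus ?thesis unfolding ev D_def .
qed

text \<open>This is the recurrence of \<open>JS\<close> in summed form, read as a statement about
  coefficients only, so \<open>T\<close> is arbitrary.\<close>

lemma JS_sum_Suc:
  fixes T :: "nat \<Rightarrow> series"
  shows "(\<Sum>k\<le>Suc n. mfps_const (JS (Suc n) k) * T k) =
    (\<Sum>k\<le>n. mfps_const (JS n k) *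
      (T (Suc k) + mfps_const (of_nat k * (of_nat k + zvar)) * T k))"
proof -
  let ?U = "\<lambda>k. mfps_const (of_nat k * (of_nat k + zvar) * JS n k) * T k"
  have c0: "mfps_const 0 = (0 :: series)"
    using mfps_const_of_nat[of 0] by simp
  \<comment> \<open>The term at 0 vanishes since \<open>JS (Suc n) 0 = 0\<close>; the recurrence
    applies to all others.\<close>
  have "(\<Sum>k\<le>Suc n. mfps_const (JS (Suc n) k) * T k) =
      (\<Sum>k\<le>n. mfps_const (JS n k) * T (Suc k)) + (\<Sum>k\<le>n. ?U (Suc k))"
    by (simp add: sum.atMost_Suc_shift c0 mfps_const_add distrib_right sum.distrib
        del: sum.atMost_Suc of_nat_Suc)
  \<comment> \<open>The added term \<open>?U 0\<close> is 0 because of its factor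
    \<open>of_nat 0\<close>.\<close>
  also have "(\<Sum>k\<le>n. ?U (Suc k)) = (\<Sum>k\<le>Suc n. ?U k)"
    by (simp add: sum.atMost_Suc_shift c0 del: sum.atMost_Suc of_nat_Suc)
  \<comment> \<open>The top term drops out by \<open>JS n (Suc n) = 0\<close>.\<close>
  also have "\<dots> = (\<Sum>k\<le>n. ?U k)"
    by (simp add: JS_eq_0 c0)
  also have "\<dots> = (\<Sum>k\<le>n. mfps_const (JS n k) *
      (mfps_const (of_nat k * (of_nat k + zvar)) * T k))"
    by (simp only: mfps_const_mult mult_ac)
  finally show ?thesis
    by (simp only: distrib_left sum.distrib)
qed

text \<open>Summing from 0 lets the induction start at the empty composition, where
  \<open>js_monom 0 = sa 0\<close>.\<close>

lemma fold_formal_derivative_grammar: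
  "fold (\<lambda>k. formal_derivative (grammar k)) [1..<Suc n] (sa 0) =
    (\<Sum>k\<le>n. mfps_const (JS n k) * js_monom k)"
proof (induction n)
  case 0
  show ?case by (simp add: js_monom_def mfps_const_1 numeral_2_eq_2)
next
  case (Suc n)
  define D where "D = formal_derivative (grammar (Suc n))"
  have isD: "is_formal_derivative (grammar (Suc n)) D"
    unfolding D_def by (rule is_formal_derivative_formal_derivative[OF finite_grammar])
  have scal: "D (mfps_const c * f) = mfps_const c * D f" for c f
    using isD unfolding is_formal_derivative_def by blast
  \<comment> \<open>\<open>fold\<close> applies the list from left to right, so the derivative of
    \<open>grammar (Suc n)\<close> acts last, and every index \<open>k \<le> n\<close> is below
    \<open>Suc n\<close>.\<close>
  have "fold (\<lambda>k. formal_derivative (grammar k)) [1..<Suc (Suc n)] (sa 0) =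
      D (\<Sum>k\<le>n. mfps_const (JS n k) * js_monom k)"
    using Suc by (simp add: D_def)
  also have "\<dots> = (\<Sum>k\<le>n. mfps_const (JS n k) * (js_monom (Suc k) +
      mfps_const (of_nat k * (of_nat k + zvar)) * js_monom k))"
    unfolding is_formal_derivative_sum[OF isD] scal
    by (intro sum.cong refl) (simp add: D_def formal_derivative_js_monom)
  finally show ?case unfolding JS_sum_Suc .
qed

theorem theorem2:
  fixes n :: nat
  assumes "n \<ge> 1"
  shows "fold (\<lambda>k. formal_derivative (grammar k)) [1..<Suc n] (sa 0) =
    (\<Sum>k = 1..n. mfps_const (JS n k) * sa k * sb ^ (k choose 2) * sc ^ k)"
proof -
  \<comment> \<open>The hypothesis \<open>n \<ge> 1\<close> removes the term at 0.\<close>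
  have "JS n 0 = 0"
    using assms by (cases n) simp_all
  moreover have "mfps_const 0 = (0 :: series)"
    using mfps_const_of_nat[of 0] by simp
  ultimately have "(\<Sum>k\<le>n. mfps_const (JS n k) * js_monom k) =
      (\<Sum>k = 1..n. mfps_const (JS n k) * js_monom k)"
    by (intro sum.mono_neutral_right) (auto simp: not_le)
  thus ?thesis
    unfolding fold_formal_derivative_grammar by (simp add: js_monom_def mult.assoc)
qed

end
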